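(* For every integer $N\ge4$, every $\rho>0$, and every $0\le\theta\le\pi$, $$\Gamma_N(T_{\rho,\theta})=\frac{\rho}{K_N(\theta)}.$$ The infimum defining $\Gamma_N(T_{\rho,\theta})$ is attained by a convex polygon $P$ with at most $N$ vertices and $0\in\operatorname{int}P$. For this polygon, $$V_P(T_{\rho,\theta}x)\le\Gamma_N(T_{\rho,\theta})V_P(x)\qquad(x\in\mathbb R^2).$$ As the angle varies, $$\min_{0\le\theta\le\pi}K_N(\theta)=\cos(\pi/N),\qquad \max_{0\le\theta\le\pi}\frac{\Gamma_N(T_{\rho,\theta})}{\rho}=\frac1{\cos(\pi/N)}.$$ For angles between $0$ and $2\pi/N$, $$K_N(\theta)=\frac{\cos(\pi/N)}{\cos(\theta-\pi/N)}\qquad(0\le\theta\le2\pi/N).$$ Both extrema displayed above are attained at $\theta=\pi/N$.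
   Context: $\Theta_N\subset\mathbb C$ is the set of all eigenvalues of real row-stochastic $N\times N$ matrices, and $K_N(\theta)=\max\{r\ge0:re^{i\theta}\in\Theta_N\}$ for $0\le\theta\le\pi$. $R_\theta$ is rotation of $\mathbb R^2$ through the angle $\theta$ and $T_{\rho,\theta}=\rho R_\theta$. For a convex polygon $P\subset\mathbb R^2$ with $0\in\operatorname{int}P$ (no symmetry is assumed), $V_P(x)=\inf\{a>0:x\in aP\}$. Finally $$\Gamma_N(T_{\rho,\theta})=\inf\{\gamma>0:T_{\rho,\theta}P\subseteq\gamma P\text{ for some convex polygon }P\text{ with at most }N\text{ vertices and }0\in\operatorname{int}P\}.$$ *)

theory Defs
  imports "HOL-Analysis.Analysis" "Jordan_Normal_Form.Char_Poly"
begin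

definition row_stochastic :: "nat \<Rightarrow> real Matrix.mat \<Rightarrow> bool" where
  "row_stochastic N A \<longleftrightarrow>
     A \<in> carrier_mat N N \<and>
     (\<forall>i<N. \<forall>j<N. 0 \<le> A $$ (i, j)) \<and>
     (\<forall>i<N. (\<Sum>j<N. A $$ (i, j)) = 1)"

definition Theta_N :: "nat \<Rightarrow> complex set" where
  "Theta_N N = {z. \<exists>A. row_stochastic N A \<and> eigenvalue (map_mat complex_of_real A) z}"

definition K_N :: "nat \<Rightarrow> real \<Rightarrow> real" where
  "K_N N \<theta> = (GREATEST r. 0 \<le> r \<and> complex_of_real r * cis \<theta> \<in> Theta_N N)"

definition R_rot :: "real \<Rightarrow> real^2^2" where
  "R_rot \<theta> = vector [vector [cos \<theta>, - sin \<theta>], vector [sin \<theta>, cos \<theta>]]"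

definition T_map :: "real \<Rightarrow> real \<Rightarrow> real^2 \<Rightarrow> real^2" where
  "T_map \<rho> \<theta> x = \<rho> *\<^sub>R (R_rot \<theta> *v x)"

definition vertices :: "(real^2) set \<Rightarrow> (real^2) set" where
  "vertices P = {v. v extreme_point_of P}"

text \<open>A polytope in the plane (the convex hull of finitely many points) may degenerate to a
  segment, a point or the empty set; the condition on the interior excludes this. A polytope
  has finitely many extreme points, so the cardinality below is a true vertex count.\<close>

definition convex_polygon :: "(real^2) set \<Rightarrow> bool" where
  "convex_polygon P \<longleftrightarrow> polytope P \<and> interior P \<noteq> {}"

definition admissible :: "nat \<Rightarrow> (real^2) set \<Rightarrow> bool" where
  "admissible N P \<longleftrightarrow> convex_polygon P \<and> card (vertices P) \<le> N \<and> 0 \<in> interior P"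

definition V_gauge :: "(real^2) set \<Rightarrow> real^2 \<Rightarrow> real" where
  "V_gauge P x = Inf {a. 0 < a \<and> x \<in> (*\<^sub>R) a ` P}"

definition Gamma_N :: "nat \<Rightarrow> (real^2 \<Rightarrow> real^2) \<Rightarrow> real" where
  "Gamma_N N f = Inf {\<gamma>. 0 < \<gamma> \<and> (\<exists>P. admissible N P \<and> f ` P \<subseteq> (*\<^sub>R) \<gamma> ` P)}"

end

theory Submission
  imports Defs "HOL-Library.Real_Mod"
begin

text \<open>
  By Dmitriev and Dynkin, \<open>z\<close> is an eigenvalue of a stochastic \<open>N \<times> N\<close> matrix iff \<open>z Q \<subseteq> Q\<close> for
  the convex hull \<open>Q \<noteq> {0}\<close> of \<open>N\<close> points: the entries of an eigenvector are the points, the rows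
  of the matrix the convex weights. Hence \<open>T P \<subseteq> \<gamma> P\<close> says that \<open>(\<rho> / \<gamma>) e\<^sup>i\<^sup>\<theta>\<close> lies in
  \<open>\<Theta>\<^sub>N\<close>, and conversely a hull invariant under a nonreal \<open>z\<close> contains \<open>0\<close> in its interior.
  Compactness of \<open>\<Theta>\<^sub>N\<close> gives attainment.

  Regular \<open>N\<close>-gons give the lower bounds for \<open>K\<^sub>N\<close>. For the upper bound, put
  \<open>\<psi> = Arg (z - 1)\<close>. Every vertex \<open>v \<noteq> 0\<close> of an invariant polygon has a successor \<open>v'\<close> at an
  angle \<open>\<alpha> \<in> (0, \<pi>)\<close> ahead with \<open>\<bar>v'\<bar> sin (\<psi> - \<alpha>) \<ge> \<bar>v\<bar> sin \<psi>\<close>. Along a cycle of successors,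
  of length \<open>m \<le> N\<close>, the moduli cancel and the angles add up to at least \<open>2\<pi>\<close>, so log-concavity
  of the sine forces \<open>\<psi> \<ge> \<pi>/2 + \<pi>/m\<close>. This says that \<open>z\<close> lies on the left of the line through
  \<open>1\<close> and \<open>e\<^sup>2\<^sup>\<pi>\<^sup>i\<^sup>/\<^sup>N\<close>.
\<close>

section \<open>Invariant point systems\<close>

text \<open>The points \<open>x i\<close> may coincide, so the weights are attached to indices
  rather than to points; in this form they can serve directly as a row of a matrix.\<close>

lemma convex_hull_image_finite:
  fixes x :: "'i \<Rightarrow> 'a::real_vector"
  assumes "finite I"
  shows "convex hull (x ` I) =
    {y. \<exists>u. (\<forall>i\<in>I. 0 \<le> u i) \<and> sum u I = 1 \<and> y = (\<Sum>i\<in>I. u i *\<^sub>R x i)}" (is "_ = ?S")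
proof
  have "x i \<in> ?S" if "i \<in> I" for i
    using that assms
    by (intro CollectI exI[of _ "\<lambda>j. if i = j then 1 else 0"]) (auto simp: if_distrib[of "\<lambda>c. c *\<^sub>R _"] cong: if_cong)
  moreover have "convex ?S"
  proof (rule convexI, clarify)
    fix u v :: real and p q :: "'i \<Rightarrow> real"
    assume uv: "0 \<le> u" "0 \<le> v" "u + v = 1" and p: "\<forall>i\<in>I. 0 \<le> p i" "sum p I = 1"
      and q: "\<forall>i\<in>I. 0 \<le> q i" "sum q I = 1"
    show "\<exists>w. (\<forall>i\<in>I. 0 \<le> w i) \<and> sum w I = 1 \<and>
        u *\<^sub>R (\<Sum>i\<in>I. p i *\<^sub>R x i) + v *\<^sub>R (\<Sum>i\<in>I. q i *\<^sub>R x i) = (\<Sum>i\<in>I. w i *\<^sub>R x i)"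
      using uv p q
      by (intro exI[of _ "\<lambda>i. u * p i + v * q i"])
        (auto simp: sum.distrib scaleR_add_left scaleR_sum_right simp flip: sum_distrib_left)
  qed
  ultimately show "convex hull (x ` I) \<subseteq> ?S" by (intro hull_minimal) blast+
  show "?S \<subseteq> convex hull (x ` I)"
  proof clarify
    fix u :: "'i \<Rightarrow> real"
    assume "\<forall>i\<in>I. 0 \<le> u i" "sum u I = 1"
    then show "(\<Sum>i\<in>I. u i *\<^sub>R x i) \<in> convex hull (x ` I)"
      using assms by (intro convex_sum convex_convex_hull) (auto simp: hull_inc)
  qed
qed

text \<open>A family rather than a set of points, so that a polygon with fewer than \<open>N\<close>
  vertices can be listed with repetitions. The nonzero entry reflects that eigenvectors are
  nonzero.\<close>

definition inv_points :: "nat \<Rightarrow> complex \<Rightarrow> (nat \<Rightarrow> complex) \<Rightarrow> bool" where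
  "inv_points N z x \<longleftrightarrow> (\<exists>i<N. x i \<noteq> 0) \<and> (\<forall>i<N. z * x i \<in> convex hull (x ` {..<N}))"

text \<open>The weights form one function on index pairs: it is both the argument of
  \<open>Matrix.mat\<close> and a point of a product space, where Tychonoff's theorem
  applies.\<close>

definition inv_weights :: "nat \<Rightarrow> complex \<Rightarrow> (nat \<Rightarrow> complex) \<Rightarrow> (nat \<times> nat \<Rightarrow> real) \<Rightarrow> bool" where
  "inv_weights N z x a \<longleftrightarrow> (\<forall>i<N. \<forall>j<N. 0 \<le> a (i, j)) \<and> (\<forall>i<N. (\<Sum>j<N. a (i, j)) = 1) \<and>
     (\<forall>i<N. z * x i = (\<Sum>j<N. a (i, j) *\<^sub>R x j))"

lemma inv_points_weights:
  "inv_points N z x \<longleftrightarrow> (\<exists>i<N. x i \<noteq> 0) \<and> (\<exists>a. inv_weights N z x a)"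
proof -
  have "(\<forall>i<N. z * x i \<in> convex hull (x ` {..<N})) \<longleftrightarrow> (\<exists>a. inv_weights N z x a)" (is "?L = ?R")
  proof
    assume ?L
    then have "\<forall>i\<in>{..<N}. \<exists>u. (\<forall>j<N. 0 \<le> u j) \<and> sum u {..<N} = 1 \<and> z * x i = (\<Sum>j<N. u j *\<^sub>R x j)"
      by (simp add: convex_hull_image_finite Ball_def)
    then obtain u where "\<forall>i\<in>{..<N}. (\<forall>j<N. 0 \<le> u i j) \<and> sum (u i) {..<N} = 1 \<and> z * x i = (\<Sum>j<N. u i j *\<^sub>R x j)"
      unfolding bchoice_iff by blast
    then have "inv_weights N z x (\<lambda>(i, j). u i j)" by (auto simp: inv_weights_def)
    then show ?R by blast
  next
    assume ?R
    then obtain a where "inv_weights N z x a" ..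
    then show ?L unfolding inv_weights_def convex_hull_image_finite[OF finite_lessThan]
      by (intro allI impI CollectI, rule_tac x = "\<lambda>j. a (i, j)" in exI) auto
  qed
  then show ?thesis by (simp add: inv_points_def)
qed

lemma mem_Theta_N_iff: "z \<in> Theta_N N \<longleftrightarrow> (\<exists>x. inv_points N z x)"
proof
  assume "z \<in> Theta_N N"
  then obtain A v where A: "row_stochastic N A" and v: "eigenvector (map_mat complex_of_real A) v z"
    unfolding Theta_N_def eigenvalue_def by blast
  have dim: "A \<in> carrier_mat N N" using A by (simp add: row_stochastic_def)
  have "v \<in> carrier_vec N" and v0: "v \<noteq> 0\<^sub>v N" and ev: "map_mat complex_of_real A *\<^sub>v v = z \<cdot>\<^sub>v v"
    using v carrier_matD(1)[OF dim] by (simp_all add: eigenvector_def)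
  then have dv: "dim_vec v = N" by simp
  have "z * vec_index v i = (\<Sum>j<N. (A $$ (i, j)) *\<^sub>R vec_index v j)" if "i < N" for i
  proof -
    have "z * vec_index v i = vec_index (map_mat complex_of_real A *\<^sub>v v) i"
      using ev that dv by simp
    also have "\<dots> = (\<Sum>j<N. (A $$ (i, j)) *\<^sub>R vec_index v j)"
      using that dim dv by (auto simp: scalar_prod_def scaleR_conv_of_real atLeast0LessThan intro!: sum.cong)
    finally show ?thesis .
  qed
  then have "inv_weights N z (vec_index v) (($$) A)"
    using A by (simp add: inv_weights_def row_stochastic_def)
  moreover have "\<exists>i<N. vec_index v i \<noteq> 0"
    using v0 dv by (auto simp: vec_eq_iff)
  ultimately show "\<exists>x. inv_points N z x" unfolding inv_points_weights by blast
next
  assume "\<exists>x. inv_points N z x"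
  then obtain x a where x: "\<exists>i<N. x i \<noteq> 0" and a: "inv_weights N z x a"
    unfolding inv_points_weights by blast
  define A where "A = Matrix.mat N N a"
  have "row_stochastic N A" using a by (auto simp: A_def row_stochastic_def inv_weights_def)
  moreover have "eigenvector (map_mat complex_of_real A) (Matrix.vec N x) z"
    unfolding eigenvector_def
  proof (intro conjI)
    show "Matrix.vec N x \<noteq> 0\<^sub>v (dim_row (map_mat complex_of_real A))"
      using x by (auto simp: A_def vec_eq_iff)
    show "map_mat complex_of_real A *\<^sub>v Matrix.vec N x = z \<cdot>\<^sub>v Matrix.vec N x"
      using a by (intro eq_vecI)
        (auto simp: A_def inv_weights_def scalar_prod_def scaleR_conv_of_real atLeast0LessThan intro!: sum.cong)
  qed (simp add: A_def)
  ultimately show "z \<in> Theta_N N" unfolding Theta_N_def eigenvalue_def by blast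
qed

section \<open>Compactness of the eigenvalue region\<close>

lemma compact_Pi_UNIV:
  fixes S :: "'b::topological_space set"
  assumes "compact S"
  shows "compact {f :: 'a \<Rightarrow> 'b. \<forall>i. f i \<in> S}"
proof -
  have "compactin (product_topology (\<lambda>_. euclidean) UNIV) (PiE UNIV (\<lambda>_::'a. S))"
    using assms unfolding compactin_PiE by simp
  moreover have "PiE UNIV (\<lambda>_::'a. S) = {f. \<forall>i. f i \<in> S}" by auto
  ultimately show ?thesis by (simp add: euclidean_product_topology)
qed

text \<open>The hull lies in the ball whose radius \<open>M\<close> is the largest modulus of its
  points, so a point of modulus \<open>M\<close> cannot be multiplied by a number of modulus above
  1.\<close>

lemma norm_Theta_N_le:
  assumes "z \<in> Theta_N N"
  shows "norm z \<le> 1"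
proof -
  obtain x where x: "inv_points N z x" using assms mem_Theta_N_iff by blast
  let ?X = "x ` {..<N}"
  have "?X \<noteq> {}" using x by (auto simp: inv_points_def)
  define M where "M = Max (norm ` ?X)"
  have M: "norm (x i) \<le> M" if "i < N" for i using that by (auto simp: M_def)
  have "M \<in> norm ` ?X" unfolding M_def using \<open>?X \<noteq> {}\<close> by (intro Max_in) auto
  then obtain i where i: "i < N" "norm (x i) = M" by auto
  have "0 < M" using x M by (auto simp: inv_points_def intro: less_le_trans[of _ "norm _"])
  have "convex hull ?X \<subseteq> cball 0 M" using M by (intro hull_minimal) auto
  then have "norm (z * x i) \<le> M" using x i by (auto simp: inv_points_def)
  then show "norm z \<le> 1" using i \<open>0 < M\<close> by (simp add: norm_mult)
qed

text \<open>The region is the projection of a compact set of triples (eigenvalue, eigenvector,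
  matrix). Normalising the sum of the moduli to 1 is a closed condition that keeps eigenvectors away
  from 0.\<close>

lemma compact_Theta_N: "compact (Theta_N N)"
proof -
  define C where "C = (cball 0 1 \<times> {x. \<forall>i. x i \<in> cball 0 1} \<times> {a. \<forall>i. a i \<in> {0..1}}) \<inter>
    {w :: complex \<times> (nat \<Rightarrow> complex) \<times> (nat \<times> nat \<Rightarrow> real).
      (\<Sum>i<N. norm (fst (snd w) i)) = 1 \<and> inv_weights N (fst w) (fst (snd w)) (snd (snd w))}"
  have cx: "continuous_on UNIV (\<lambda>w :: complex \<times> (nat \<Rightarrow> complex) \<times> (nat \<times> nat \<Rightarrow> real). fst (snd w) i)" for i
    by (rule continuous_on_product_then_coordinatewise) (intro continuous_intros)
  have ca: "continuous_on UNIV (\<lambda>w :: complex \<times> (nat \<Rightarrow> complex) \<times> (nat \<times> nat \<Rightarrow> real). snd (snd w) i)" for i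
    by (rule continuous_on_product_then_coordinatewise) (intro continuous_intros)
  have "compact C" unfolding C_def inv_weights_def
    by (intro compact_Int_closed compact_Times compact_Pi_UNIV compact_cball compact_Icc
        closed_Collect_conj closed_Collect_all closed_Collect_imp open_Collect_const
        closed_Collect_le closed_Collect_eq continuous_intros cx ca)
  then have "compact (fst ` C)"
    by (rule compact_continuous_image[rotated]) (intro continuous_intros)
  moreover have "fst ` C = Theta_N N"
  proof (intro equalityI subsetI)
    fix z assume "z \<in> fst ` C"
    then obtain x a where "(\<Sum>i<N. norm (x i)) = 1" "inv_weights N z x a" by (auto simp: C_def)
    moreover from this have "\<exists>i<N. x i \<noteq> 0" by (metis lessThan_iff norm_zero sum.neutral zero_neq_one)
    ultimately show "z \<in> Theta_N N" unfolding mem_Theta_N_iff inv_points_weights by blast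
  next
    fix z assume z: "z \<in> Theta_N N"
    then obtain x a where x: "\<exists>i<N. x i \<noteq> 0" and a: "inv_weights N z x a"
      unfolding mem_Theta_N_iff inv_points_weights by blast
    define s where "s = (\<Sum>i<N. norm (x i))"
    have "s > 0" using x unfolding s_def by (auto intro: sum_pos2)
    \<comment> \<open>\<open>C\<close> bounds all coordinates, including those beyond
      \<open>N\<close>; there both functions are set to 0.\<close>
    define y where "y i = (if i < N then x i /\<^sub>R s else 0)" for i
    define b where "b p = (if fst p < N \<and> snd p < N then a p else 0)" for p
    have y1: "(\<Sum>i<N. norm (y i)) = 1" using \<open>s > 0\<close>
      by (simp add: y_def s_def flip: sum_divide_distrib sum_distrib_left)
    have "norm (y i) \<le> 1" for i
    proof (cases "i < N")
      case True
      then have "norm (y i) \<le> (\<Sum>i<N. norm (y i))" by (intro member_le_sum) auto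
      then show ?thesis using y1 by simp
    qed (simp add: y_def)
    moreover have w: "inv_weights N z y b"
      using a by (simp add: inv_weights_def y_def b_def scaleR_sum_right mult.commute)
    moreover have "b p \<le> 1" for p
    proof (cases "fst p < N \<and> snd p < N")
      case True
      then have "b (fst p, snd p) \<le> (\<Sum>j<N. b (fst p, j))"
        using w by (intro member_le_sum[of _ _ "\<lambda>j. b (fst p, j)"]) (auto simp: inv_weights_def)
      then show ?thesis using w True by (auto simp: inv_weights_def)
    qed (auto simp: b_def)
    moreover have "0 \<le> b p" for p
      using w by (cases p) (auto simp: inv_weights_def b_def)
    ultimately have "(z, y, b) \<in> C" using y1 norm_Theta_N_le[OF z] by (auto simp: C_def)
    then show "z \<in> fst ` C" by force
  qed
  ultimately show ?thesis by simp
qed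

text \<open>\<open>GREATEST\<close> says nothing until a maximum is known to exist; it exists
  because the admissible radii form a nonempty compact subset of \<open>{0..1}\<close>.\<close>

lemma K_N_greatest:
  assumes "2 \<le> N"
  shows "0 \<le> K_N N \<theta>" "complex_of_real (K_N N \<theta>) * cis \<theta> \<in> Theta_N N"
    "\<And>r. 0 \<le> r \<Longrightarrow> complex_of_real r * cis \<theta> \<in> Theta_N N \<Longrightarrow> r \<le> K_N N \<theta>"
proof -
  define S where "S = {0..1} \<inter> {r. complex_of_real r * cis \<theta> \<in> Theta_N N}"
  have S: "r \<in> S \<longleftrightarrow> 0 \<le> r \<and> complex_of_real r * cis \<theta> \<in> Theta_N N" for r
    using norm_Theta_N_le[of "complex_of_real r * cis \<theta>" N] by (auto simp: S_def norm_mult)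
  have "closed {r. complex_of_real r * cis \<theta> \<in> Theta_N N}"
    using continuous_closed_vimage[OF compact_imp_closed[OF compact_Theta_N, of N], of "\<lambda>r. complex_of_real r * cis \<theta>"]
    by (simp add: vimage_def)
  then have "compact S" unfolding S_def by (intro compact_Int_closed compact_Icc)
  \<comment> \<open>The hull must contain 0, which the point with index 1 supplies; this is where
    \<open>2 \<le> N\<close> enters.\<close>
  have "inv_points N 0 (\<lambda>i. if i = 0 then 1 else 0)"
    using assms by (auto simp: inv_points_def intro!: hull_inc image_eqI[of _ _ 1])
  then have "0 \<in> S" by (auto simp: S mem_Theta_N_iff)
  then obtain m where m: "m \<in> S" "\<And>r. r \<in> S \<Longrightarrow> r \<le> m"
    using compact_attains_sup[OF \<open>compact S\<close>] by blast
  have "K_N N \<theta> = m" unfolding K_N_def using m by (intro Greatest_equality) (auto simp: S)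
  then show "0 \<le> K_N N \<theta>" "complex_of_real (K_N N \<theta>) * cis \<theta> \<in> Theta_N N"
    "\<And>r. 0 \<le> r \<Longrightarrow> complex_of_real r * cis \<theta> \<in> Theta_N N \<Longrightarrow> r \<le> K_N N \<theta>"
    using m by (auto simp: S)
qed

section \<open>Upper bound\<close>

text \<open>The function \<open>- ln (sin x)\<close> is convex on the interval from 0 to
  \<open>pi\<close>, its second derivative being \<open>1 / (sin x)^2\<close>, so it lies above its
  tangent at \<open>s\<close>. Exponentiation gives the claim.\<close>

lemma sin_le_exp_tangent:
  assumes "0 < s" "s < pi" "0 < t" "t < pi"
  shows "sin t \<le> sin s * exp (cot s * (t - s))"
proof -
  have deriv: "((\<lambda>x. - ln (sin x)) has_real_derivative - (cos x / sin x)) (at x)"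
    if "x \<in> {0<..<pi}" for x
    using that sin_gt_zero[of x] by (auto intro!: derivative_eq_intros)
  have cvx: "convex_on {0<..<pi} (\<lambda>x. - ln (sin x))"
  proof (rule f''_ge0_imp_convex)
    fix x assume x: "x \<in> {0<..<pi}"
    then show "((\<lambda>x. - ln (sin x)) has_real_derivative - (cos x / sin x)) (at x)"
      by (rule deriv)
    have "sin x > 0" using x by (simp add: sin_gt_zero)
    show "((\<lambda>x. - (cos x / sin x)) has_real_derivative 1 / (sin x * sin x)) (at x)"
    proof -
      have "((\<lambda>x. - (cos x / sin x)) has_real_derivative
          - ((- sin x * sin x - cos x * cos x) / (sin x * sin x))) (at x)"
        using \<open>sin x > 0\<close> by (intro DERIV_minus DERIV_divide DERIV_cos DERIV_sin) simp
      also have "- ((- sin x * sin x - cos x * cos x) / (sin x * sin x)) = 1 / (sin x * sin x)"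
      proof -
        have "- sin x * sin x - cos x * cos x = -1" using sin_cos_squared_add3[of x] by linarith
        then show ?thesis by simp
      qed
      finally show ?thesis .
    qed
    show "0 \<le> 1 / (sin x * sin x)" by simp
  qed auto
  have pos: "sin s > 0" "sin t > 0" using assms by (auto simp: sin_gt_zero)
  have "((\<lambda>x. - ln (sin x)) has_real_derivative - (cos s / sin s)) (at s within {0<..<pi})"
    using assms by (intro has_field_derivative_at_within[OF deriv]) simp
  then have "- (cos s / sin s) * (t - s) \<le> - ln (sin t) - - ln (sin s)"
    using assms by (intro convex_on_imp_above_tangent[OF cvx]) (auto simp: interior_open)
  then have "ln (sin t) \<le> ln (sin s) + cot s * (t - s)" by (simp add: cot_def)
  then have "exp (ln (sin t)) \<le> exp (ln (sin s) + cot s * (t - s))" by simp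
  then show ?thesis using pos by (simp add: exp_add)
qed

lemma extreme_point_of_injective_linear_image:
  assumes "v extreme_point_of S" "linear f" "inj f"
  shows "f v extreme_point_of f ` S"
  using assms by (auto simp: extreme_point_of_def open_segment_linear_image inj_def)

text \<open>With \<open>g z x = Im (cnj (x - 1) * (z - 1))\<close>, a point \<open>x\<close> of \<open>V\<close> as in the conclusion lies
  ahead of \<open>1\<close> as seen from the origin, and \<open>z\<close> lies weakly to the left of the ray from \<open>1\<close>
  through \<open>x\<close>. It plays the part of the next vertex of the polygon, so that no cyclic ordering of
  the vertices is needed.\<close>

lemma hull_successor_of_one:
  fixes V :: "complex set"
  defines "g \<equiv> \<lambda>z x. (Re x - 1) * Im z - Im x * (Re z - 1)"
  assumes ext: "1 extreme_point_of (convex hull V)" and "0 \<in> convex hull V"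
    and z: "z \<in> convex hull V" "Im z > 0"
  shows "\<exists>x\<in>V. Im x > 0 \<and> 0 \<le> g z x"
proof (rule ccontr)
  let ?Q = "convex hull V"
  assume none: "\<not> ?thesis"
  \<comment> \<open>Otherwise the segment from 0 to \<open>p\<close> meets the line through 1 and
    \<open>z\<close> either at 1 or at a point \<open>m\<close> beyond 1 as seen from
    \<open>z\<close>. In both cases 1 lies inside a segment of the hull and is not extreme.\<close>
  have below: "g z p \<le> 0" if p: "p \<in> ?Q" "Im p \<le> 0" for p
  proof (rule ccontr)
    assume "\<not> g z p \<le> 0"
    then have gp: "g z p > 0" by simp
    \<comment> \<open>The map \<open>g z\<close> is affine with \<open>g z 0 = - Im z\<close>; this
      \<open>t\<close> is the zero of \<open>g z\<close> along the segment from 0 to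
      \<open>p\<close>.\<close>
    define t where "t = Im z / (g z p + Im z)"
    have t: "0 < t" "t < 1" using z gp by (auto simp: t_def field_simps)
    define m where "m = t *\<^sub>R p"
    have mQ: "m \<in> ?Q"
      using convexD[OF convex_convex_hull \<open>0 \<in> ?Q\<close> p(1), of "1 - t" t] t by (simp add: m_def)
    have "t * (g z p + Im z) = Im z" using z gp by (simp add: t_def)
    then have gm: "(Re m - 1) * Im z = Im m * (Re z - 1)" by (simp add: g_def m_def algebra_simps)
    define s where "s = Im m / Im z"
    have "s \<le> 0" using p t z by (simp add: s_def m_def divide_nonpos_pos mult_nonneg_nonpos)
    have "Re m - 1 = s * (Re z - 1)"
      using z gm by (simp add: s_def eq_divide_eq)
    then have ms: "m = 1 + s *\<^sub>R (z - 1)"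
      using z by (simp add: complex_eq_iff s_def)
    show False
    proof (cases "s = 0")
      case True
      then have "t *\<^sub>R p = 1" using ms by (simp add: m_def)
      then have "1 \<in> open_segment 0 p" using t
        by (auto simp: in_segment intro!: exI[of _ t])
      then show False using ext p \<open>0 \<in> ?Q\<close> by (auto simp: extreme_point_of_def)
    next
      case False
      then have "s < 0" using \<open>s \<le> 0\<close> by simp
      \<comment> \<open>Solves \<open>s + u * (1 - s) = 0\<close>, so that weight \<open>u\<close>
        on \<open>z\<close> and \<open>1 - u\<close> on \<open>m\<close> gives 1.\<close>
      define u where "u = - s / (1 - s)"
      have u: "0 < u" "u < 1" "u * (1 - s) = - s" using \<open>s < 0\<close> by (auto simp: u_def field_simps)
      have "(1 - u) *\<^sub>R m + u *\<^sub>R z = 1 + (s + u * (1 - s)) *\<^sub>R (z - 1)"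
        by (simp add: ms algebra_simps)
      then have "1 = (1 - u) *\<^sub>R m + u *\<^sub>R z" using u by simp
      moreover have "m \<noteq> z" using z \<open>s \<le> 0\<close> p t by (auto simp: m_def zero_less_mult_iff)
      ultimately have "1 \<in> open_segment m z" using u by (auto simp: in_segment)
      then show False using ext mQ z by (auto simp: extreme_point_of_def)
    qed
  qed
  \<comment> \<open>The lexicographic halfspace keeps the strict inequality for points with \<open>Im x > 0\<close>,
    which the plain halfspace \<open>g z x \<le> 0\<close> would lose.\<close>
  define D where "D = {x. g z x < 0 \<or> g z x \<le> 0 \<and> Im x \<le> 0}"
  have "convex D"
  proof (rule convexI)
    fix x y and u v :: real
    assume xy: "x \<in> D" "y \<in> D" and uv: "0 \<le> u" "0 \<le> v" "u + v = 1"
    have v: "v = 1 - u" using uv by simp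
    have g: "g z (u *\<^sub>R x + v *\<^sub>R y) = u * g z x + v * g z y"
      by (simp add: g_def v algebra_simps)
    have I: "Im (u *\<^sub>R x + v *\<^sub>R y) = u * Im x + v * Im y" by simp
    have le: "u * g z x \<le> 0" "v * g z y \<le> 0" using xy uv by (auto simp: D_def mult_nonneg_nonpos)
    have "g z x < 0 \<or> g z y < 0 \<or> g z x \<le> 0 \<and> g z y \<le> 0 \<and> Im x \<le> 0 \<and> Im y \<le> 0"
      using xy by (auto simp: D_def)
    then consider "u = 0" | "v = 0" | "u > 0" "v > 0" "g z x < 0 \<or> g z y < 0"
      | "g z x \<le> 0" "g z y \<le> 0" "Im x \<le> 0" "Im y \<le> 0"
      using uv by (metis order_le_less)
    then show "u *\<^sub>R x + v *\<^sub>R y \<in> D"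
    proof cases
      case 3
      then have "u * g z x < 0 \<or> v * g z y < 0" by (auto simp: mult_pos_neg)
      then show ?thesis using le unfolding D_def mem_Collect_eq g by linarith
    next
      case 4
      then have "u * Im x \<le> 0" "v * Im y \<le> 0" using uv by (auto simp: mult_nonneg_nonpos)
      then show ?thesis using le unfolding D_def mem_Collect_eq g I by auto
    qed (use uv xy in auto)
  qed
  moreover have "V \<subseteq> D" using none below by (force simp: D_def hull_inc)
  ultimately have "?Q \<subseteq> D" by (rule hull_minimal[rotated])
  \<comment> \<open>\<open>g z z = 0\<close> and \<open>Im z > 0\<close>, so \<open>z\<close> is not
    in \<open>D\<close>.\<close>
  then show False using z by (auto simp: D_def g_def)
qed

text \<open>Division by \<open>v\<close> moves the vertex to 1 and reduces to the preceding lemma.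
  In polar coordinates for \<open>x / v\<close> and \<open>z - 1\<close>, the sign condition on
  \<open>g\<close> becomes the sine inequality.\<close>

lemma hull_successor:
  fixes V :: "complex set"
  assumes ext: "v extreme_point_of (convex hull V)" and "v \<noteq> 0" and "0 \<in> convex hull V"
    and z: "z * v \<in> convex hull V" "Im z > 0"
  shows "\<exists>x\<in>V. Im (x / v) > 0 \<and> sin (Arg (z - 1)) \<le> norm (x / v) * sin (Arg (z - 1) - Arg (x / v))"
proof -
  let ?f = "\<lambda>x. x / v"
  have lin: "linear ?f" by (intro linearI) (auto simp: add_divide_distrib scaleR_conv_of_real)
  have inj: "inj ?f" using \<open>v \<noteq> 0\<close> by (auto simp: inj_def)
  have hull: "convex hull (?f ` V) = ?f ` (convex hull V)"
    by (rule convex_hull_linear_image[OF lin, symmetric])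
  have "\<exists>x\<in>?f ` V. Im x > 0 \<and> 0 \<le> (Re x - 1) * Im z - Im x * (Re z - 1)"
  proof (rule hull_successor_of_one)
    show "1 extreme_point_of (convex hull (?f ` V))"
      using extreme_point_of_injective_linear_image[OF ext lin inj] \<open>v \<noteq> 0\<close> by (simp add: hull)
    show "0 \<in> convex hull (?f ` V)" unfolding hull using \<open>0 \<in> convex hull V\<close> by force
    show "z \<in> convex hull (?f ` V)" unfolding hull using z \<open>v \<noteq> 0\<close> by force
  qed fact
  then obtain x where x: "x \<in> V" "Im (x / v) > 0"
    and g: "0 \<le> (Re (x / v) - 1) * Im z - Im (x / v) * (Re z - 1)" by blast
  define w where "w = x / v"
  define \<psi> where "\<psi> = Arg (z - 1)"
  define s where "s = norm (z - 1)"
  have "s > 0" using z by (auto simp: s_def)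
  have "z - 1 = of_real s * cis \<psi>" by (simp add: s_def \<psi>_def rcis_cmod_Arg flip: rcis_def)
  then have zz: "Re z - 1 = s * cos \<psi>" "Im z = s * sin \<psi>"
    by (auto simp: complex_eq_iff)
  have ww: "Re w = norm w * cos (Arg w)" "Im w = norm w * sin (Arg w)"
    by (metis Re_rcis rcis_cmod_Arg, metis Im_rcis rcis_cmod_Arg)
  have "(Re w - 1) * Im z - Im w * (Re z - 1) = s * (norm w * sin (\<psi> - Arg w) - sin \<psi>)"
    unfolding zz ww by (simp add: sin_diff algebra_simps)
  then have "0 \<le> norm w * sin (\<psi> - Arg w) - sin \<psi>"
    using g \<open>s > 0\<close> by (simp add: w_def zero_le_mult_iff)
  then show ?thesis using x by (auto simp: w_def \<psi>_def)
qed

section \<open>Cycles of successors and their total angle\<close>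

lemma finite_orbit_cycle:
  assumes "finite V" "card V \<le> N" and "\<And>k. u k \<in> V"
  obtains i m :: nat where "0 < m" "m \<le> N" "u (i + m) = u i"
proof -
  have "\<not> inj_on u {..N}"
  proof
    assume "inj_on u {..N}"
    then have "card {..N} \<le> card V" using assms by (intro card_inj_on_le[of u]) auto
    then show False using assms by simp
  qed
  then obtain i j where ij: "i \<le> N" "j \<le> N" "i < j" "u i = u j"
    unfolding inj_on_def by (metis atMost_iff linorder_neqE_nat)
  then show thesis by (intro that[of "j - i" i]) auto
qed

text \<open>Since the product is 1, the angles add up to an integer multiple of
  \<open>2 * pi\<close>; since each factor lies in the upper half-plane, the multiple is
  positive.\<close>

lemma sum_Arg_ge_2pi:
  fixes w :: "nat \<Rightarrow> complex"
  assumes "0 < m" and prod: "(\<Prod>k<m. w k) = 1" and Im: "\<And>k. Im (w k) > 0"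
  shows "2 * pi \<le> (\<Sum>k<m. Arg (w k))"
proof -
  have "(\<Prod>k<n. w k) = of_real (\<Prod>k<n. norm (w k)) * cis (\<Sum>k<n. Arg (w k))" for n
  proof (induction n)
    case (Suc n)
    have "w n = of_real (norm (w n)) * cis (Arg (w n))" by (simp add: rcis_cmod_Arg flip: rcis_def)
    then have "(\<Prod>k<Suc n. w k) = of_real (\<Prod>k<n. norm (w k)) * cis (\<Sum>k<n. Arg (w k)) *
        (of_real (norm (w n)) * cis (Arg (w n)))"
      using Suc by simp
    then show ?case by (simp add: mult_ac flip: cis_mult)
  qed simp
  moreover have "(\<Prod>k<m. norm (w k)) = 1" using prod by (metis norm_one prod_norm)
  ultimately have "cis (\<Sum>k<m. Arg (w k)) = 1" using prod by (metis mult_1 of_real_1)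
  then obtain n :: int where n: "(\<Sum>k<m. Arg (w k)) = of_int n * (2 * pi)"
    unfolding cis_eq_1_iff ..
  have "0 < Arg (w k)" for k using Im[of k] Arg_lt_pi[of "w k"] by simp
  then have "0 < (\<Sum>k<m. Arg (w k))" using \<open>0 < m\<close> by (intro sum_pos) auto
  then have "0 < n" unfolding n by (simp add: zero_less_mult_iff)
  then have "1 * (2 * pi) \<le> of_int n * (2 * pi)" by (intro mult_right_mono) auto
  then show ?thesis unfolding n by simp
qed

text \<open>Multiplying the inequalities along the cycle removes the moduli. Log-concavity makes
  equal angles \<open>2 * \<psi> - pi\<close> the extremal case, and \<open>m\<close> of them must
  reach \<open>2 * pi\<close>.\<close>

lemma cycle_angle_bound:
  fixes w :: "nat \<Rightarrow> complex"
  assumes \<psi>: "0 < \<psi>" "\<psi> < pi" and "0 < m" and prod: "(\<Prod>k<m. w k) = 1"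
    and Im: "\<And>k. Im (w k) > 0" and le: "\<And>k. sin \<psi> \<le> norm (w k) * sin (\<psi> - Arg (w k))"
  shows "pi / 2 + pi / m \<le> \<psi>"
proof -
  have normprod: "(\<Prod>k<m. norm (w k)) = 1" using prod by (metis norm_one prod_norm)
  have sin\<psi>: "sin \<psi> > 0" using \<psi> by (simp add: sin_gt_zero)
  have npos: "norm (w k) > 0" for k using Im[of k] by auto
  have Arg: "0 < Arg (w k)" "Arg (w k) < pi" for k using Im[of k] Arg_lt_pi[of "w k"] by auto
  have sin_pos: "sin (\<psi> - Arg (w k)) > 0" for k
    using less_le_trans[OF sin\<psi> le[of k]] npos[of k] by (simp add: zero_less_mult_iff)
  have lt: "Arg (w k) < \<psi>" for k
  proof (rule ccontr)
    assume "\<not> Arg (w k) < \<psi>"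
    then have "sin (Arg (w k) - \<psi>) \<ge> 0" using \<psi> Arg[of k] by (intro sin_ge_zero) auto
    then show False using sin_pos[of k] sin_minus[of "\<psi> - Arg (w k)"] by simp
  qed
  \<comment> \<open>This makes the tangent slope \<open>c\<close> positive. For
    \<open>\<psi> \<le> pi / 2\<close> the sine increases up to \<open>\<psi>\<close>, so every
    factor would have modulus above 1.\<close>
  have \<psi>2: "\<psi> > pi / 2"
  proof (rule ccontr)
    assume *: "\<not> ?thesis"
    have "1 < norm (w k)" for k
    proof -
      have "sin (\<psi> - Arg (w k)) < sin \<psi>"
        using * Arg[of k] lt[of k] by (intro sin_monotone_2pi) auto
      also have "\<dots> \<le> norm (w k) * sin (\<psi> - Arg (w k))" by (rule le)
      finally have "1 * sin (\<psi> - Arg (w k)) < norm (w k) * sin (\<psi> - Arg (w k))" by simp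
      then show ?thesis using sin_pos[of k] by (simp only: mult_less_cancel_right_pos)
    qed
    then have "1 < (\<Prod>k<m. norm (w k))" using \<open>0 < m\<close> by (intro less_1_prod) auto
    then show False using normprod by simp
  qed
  \<comment> \<open>Tangent to \<open>ln \<circ> sin\<close> at \<open>pi - \<psi>\<close>: there \<open>sin\<close> takes the value \<open>sin \<psi>\<close>, which cancels.\<close>
  define c where "c = cot (pi - \<psi>)"
  have "cos (pi - \<psi>) > 0" "sin (pi - \<psi>) > 0"
    using \<psi>2 \<psi> by (intro cos_gt_zero sin_gt_zero; linarith)+
  then have "c > 0" unfolding c_def cot_def by (rule divide_pos_pos)
  define S where "S = (\<Sum>k<m. Arg (w k))"
  have step: "1 \<le> norm (w k) * exp (c * (2 * \<psi> - pi - Arg (w k)))" for k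
  proof -
    have "sin (\<psi> - Arg (w k)) \<le> sin (pi - \<psi>) * exp (c * ((\<psi> - Arg (w k)) - (pi - \<psi>)))"
      unfolding c_def using \<psi> Arg[of k] lt[of k] by (intro sin_le_exp_tangent) auto
    then have "norm (w k) * sin (\<psi> - Arg (w k)) \<le> norm (w k) * (sin \<psi> * exp (c * (2 * \<psi> - pi - Arg (w k))))"
      by (intro mult_left_mono) (auto simp: algebra_simps)
    then have "sin \<psi> * 1 \<le> sin \<psi> * (norm (w k) * exp (c * (2 * \<psi> - pi - Arg (w k))))"
      using le[of k] by (simp add: mult_ac)
    then show ?thesis using sin\<psi> by (simp only: mult_le_cancel_left_pos)
  qed
  have "1 \<le> (\<Prod>k<m. norm (w k) * exp (c * (2 * \<psi> - pi - Arg (w k))))"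
    using step by (intro prod_ge_1) auto
  also have "\<dots> = exp (\<Sum>k<m. c * (2 * \<psi> - pi - Arg (w k)))"
    by (simp add: prod.distrib normprod exp_sum)
  also have "(\<Sum>k<m. c * (2 * \<psi> - pi - Arg (w k))) = c * (m * (2 * \<psi> - pi) - S)"
    by (simp add: S_def sum_subtractf flip: sum_distrib_left)
  finally have "S \<le> m * (2 * \<psi> - pi)" using \<open>c > 0\<close> by (simp add: zero_le_mult_iff)
  moreover have "2 * pi \<le> S" unfolding S_def by (rule sum_Arg_ge_2pi) fact+
  ultimately show ?thesis using \<open>0 < m\<close> by (simp add: field_simps)
qed

section \<open>The half-plane bound for invariant point systems\<close>

lemma inv_points_mult_hull:
  fixes z :: complex
  assumes "\<forall>i<N. z * x i \<in> convex hull (x ` {..<N})" "y \<in> convex hull (x ` {..<N})"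
  shows "z * y \<in> convex hull (x ` {..<N})"
proof -
  have "z * y \<in> (*) z ` (convex hull (x ` {..<N}))" using assms by blast
  also have "\<dots> = convex hull ((*) z ` x ` {..<N})"
    by (rule convex_hull_linear_image) (auto intro!: linearI simp: distrib_left)
  also have "\<dots> \<subseteq> convex hull (x ` {..<N})" using assms by (intro hull_minimal) auto
  finally show ?thesis .
qed

text \<open>Multiplication by \<open>z\<close> maps the compact convex hull into itself. By Brouwer
  it has a fixed point there, and for \<open>z \<noteq> 1\<close> the only fixed point is 0.\<close>

lemma inv_points_zero_mem_hull:
  assumes x: "inv_points N z x" and "z \<noteq> 1"
  shows "0 \<in> convex hull (x ` {..<N})"
proof -
  have "x ` {..<N} \<noteq> {}" using x by (auto simp: inv_points_def)
  then obtain y where y: "y \<in> convex hull (x ` {..<N})" "z * y = y"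
    using brouwer[of "convex hull (x ` {..<N})" "(*) z"] inv_points_mult_hull[of N z x] x
    by (auto simp: inv_points_def finite_imp_compact_convex_hull intro!: continuous_intros)
  have "(z - 1) * y = 0" using y by (simp add: algebra_simps)
  then show ?thesis using y \<open>z \<noteq> 1\<close> by simp
qed

lemma inv_points_upper_bound:
  assumes x: "inv_points N z x" and z: "Im z > 0"
  shows "Re z * cos (pi / N) + Im z * sin (pi / N) \<le> cos (pi / N)"
proof -
  define Q where "Q = convex hull (x ` {..<N})"
  define V where "V = {v. v extreme_point_of Q}"
  have "0 < N" using x by (auto simp: inv_points_def)
  have QV: "Q = convex hull V" unfolding Q_def V_def by (rule Krein_Milman_polytope) simp
  have VX: "V \<subseteq> x ` {..<N}" unfolding V_def Q_def by (rule extreme_points_of_convex_hull)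
  have "finite V" using VX by (rule finite_subset) simp
  have "card V \<le> N" using card_mono[OF _ VX] card_image_le[of "{..<N}" x] by simp
  have "V \<subseteq> Q" by (auto simp: V_def extreme_point_of_def)
  have zQ: "z * y \<in> Q" if "y \<in> Q" for y
    using inv_points_mult_hull x that by (auto simp: Q_def inv_points_def)
  have "z \<noteq> 1" using z by auto
  then have 0: "0 \<in> Q" unfolding Q_def using inv_points_zero_mem_hull x by blast
  \<comment> \<open>Successors are described by the quotients \<open>x / v\<close>, so a possible
    vertex at 0 is removed.\<close>
  define W where "W = V - {0}"
  define \<psi> where "\<psi> = Arg (z - 1)"
  have \<psi>: "0 < \<psi>" "\<psi> < pi" using Arg_lt_pi[of "z - 1"] z by (auto simp: \<psi>_def)
  have "W \<noteq> {}"
  proof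
    assume "W = {}"
    then have "Q \<subseteq> {0}" unfolding QV W_def by (intro hull_minimal) auto
    moreover have "x i \<in> Q" if "i < N" for i using that by (simp add: Q_def hull_inc)
    ultimately show False using x by (auto simp: inv_points_def)
  qed
  then obtain v0 where v0: "v0 \<in> W" by blast
  have "\<exists>x\<in>W. Im (x / v) > 0 \<and> sin \<psi> \<le> norm (x / v) * sin (\<psi> - Arg (x / v))" if "v \<in> W" for v
  proof -
    have "\<exists>x\<in>V. Im (x / v) > 0 \<and> sin \<psi> \<le> norm (x / v) * sin (\<psi> - Arg (x / v))"
    proof -
      have "v extreme_point_of Q" "v \<noteq> 0" "v \<in> Q" using that \<open>V \<subseteq> Q\<close> by (auto simp: W_def V_def)
      then show ?thesis unfolding \<psi>_def using 0 zQ[of v] z by (intro hull_successor) (simp_all add: QV)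
    qed
    \<comment> \<open>\<open>Im (x / v) > 0\<close> excludes \<open>x = 0\<close>, so the successor
      stays in \<open>W\<close>.\<close>
    then show ?thesis by (force simp: W_def)
  qed
  then have "\<exists>\<sigma>. \<forall>v\<in>W. \<sigma> v \<in> W \<and> Im (\<sigma> v / v) > 0 \<and> sin \<psi> \<le> norm (\<sigma> v / v) * sin (\<psi> - Arg (\<sigma> v / v))"
    by (intro bchoice) blast
  then obtain \<sigma> where \<sigma>: "\<And>v. v \<in> W \<Longrightarrow> \<sigma> v \<in> W" "\<And>v. v \<in> W \<Longrightarrow> Im (\<sigma> v / v) > 0"
    "\<And>v. v \<in> W \<Longrightarrow> sin \<psi> \<le> norm (\<sigma> v / v) * sin (\<psi> - Arg (\<sigma> v / v))" by blast
  define u where "u k = (\<sigma> ^^ k) v0" for k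
  have uW: "u k \<in> W" for k by (induction k) (auto simp: u_def v0 \<sigma>)
  have uSuc: "u (Suc k) = \<sigma> (u k)" for k by (simp add: u_def)
  obtain i m where im: "0 < m" "m \<le> N" "u (i + m) = u i"
  proof (rule finite_orbit_cycle[OF \<open>finite V\<close> \<open>card V \<le> N\<close>])
    show "u k \<in> V" for k using uW by (simp add: W_def)
  qed
  \<comment> \<open>The product of these quotients telescopes and is 1 around the cycle.\<close>
  define w where "w k = u (Suc (i + k)) / u (i + k)" for k
  have "(\<Prod>k<n. w k) = u (i + n) / u i" for n
    using uW by (induction n) (auto simp: w_def W_def)
  then have "(\<Prod>k<m. w k) = 1" using im uW[of i] by (simp add: W_def)
  then have "pi / 2 + pi / m \<le> \<psi>"
    using \<psi> im \<sigma>[OF uW] by (intro cycle_angle_bound[of _ _ w]) (auto simp: w_def uSuc)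
  \<comment> \<open>Shorter cycles give stronger bounds, so length \<open>N\<close> is the worst
    case.\<close>
  moreover have "pi / N \<le> pi / m" using im by (intro divide_left_mono) auto
  ultimately have \<psi>N: "pi / 2 + pi / N \<le> \<psi>" by simp
  have "0 \<le> pi / N" by simp
  have "cos (\<psi> - pi / N) \<le> cos (pi / 2)"
    using \<psi>N \<psi> \<open>0 \<le> pi / N\<close> by (intro cos_monotone_0_pi_le) linarith+
  \<comment> \<open>The left side is the component of \<open>z - 1\<close> along
    \<open>cis (pi / N)\<close>, the normal of the line through 1 and
    \<open>cis (2 * pi / N)\<close>.\<close>
  then have "norm (z - 1) * cos (\<psi> - pi / N) \<le> 0" by (intro mult_nonneg_nonpos) auto
  moreover have "z - 1 = rcis (norm (z - 1)) \<psi>" by (simp add: \<psi>_def rcis_cmod_Arg)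
  then have "Re z - 1 = norm (z - 1) * cos \<psi>" "Im z = norm (z - 1) * sin \<psi>"
    by (metis minus_complex.sel(1) one_complex.sel(1) Re_rcis,
        metis minus_complex.sel(2) one_complex.sel(2) Im_rcis diff_zero)
  ultimately have "(Re z - 1) * cos (pi / N) + Im z * sin (pi / N) \<le> 0"
    by (simp add: cos_diff algebra_simps)
  then show ?thesis by (simp add: algebra_simps)
qed

section \<open>Polygons in the plane and their gauges\<close>

definition plane_vec :: "complex \<Rightarrow> real^2" where
  "plane_vec z = vector [Re z, Im z]"

lemma linear_plane_vec: "linear plane_vec"
  by (intro linearI) (auto simp: plane_vec_def Finite_Cartesian_Product.vec_eq_iff forall_2)

lemma bij_plane_vec: "bij plane_vec"
proof (rule bijI)
  show "inj plane_vec"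
    by (auto simp: inj_def plane_vec_def Finite_Cartesian_Product.vec_eq_iff forall_2 complex_eq_iff)
  have "v = plane_vec (Complex (vec_nth v 1) (vec_nth v 2))" for v
    by (simp add: plane_vec_def Finite_Cartesian_Product.vec_eq_iff forall_2)
  then show "surj plane_vec" by (rule surjI[OF sym])
qed

lemma T_map_plane_vec: "T_map \<rho> \<theta> (plane_vec z) = plane_vec (of_real \<rho> * cis \<theta> * z)"
  by (simp add: T_map_def R_rot_def plane_vec_def Finite_Cartesian_Product.vec_eq_iff forall_2
      matrix_vector_mult_def sum_2 algebra_simps)

lemma linear_T_map: "linear (T_map \<rho> \<theta>)"
  unfolding T_map_def
  by (intro linear_compose_scale_right matrix_vector_mul_linear)

lemma T_map_subset_imp_Theta_N:
  assumes P: "admissible N P" and "0 < \<gamma>" and sub: "T_map \<rho> \<theta> ` P \<subseteq> (*\<^sub>R) \<gamma> ` P"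
  shows "complex_of_real (\<rho> / \<gamma>) * cis \<theta> \<in> Theta_N N"
proof -
  define f :: "real^2 \<Rightarrow> complex" where "f v = Complex (vec_nth v 1) (vec_nth v 2)" for v
  have f: "plane_vec (f v) = v" "f (plane_vec z) = z" for v z
    by (simp_all add: f_def plane_vec_def Finite_Cartesian_Product.vec_eq_iff forall_2)
  have lf: "linear f" by (intro linearI) (simp_all add: f_def complex_eq_iff)
  define V where "V = vertices P"
  obtain S where S: "finite S" "P = convex hull S"
    using P by (auto simp: admissible_def convex_polygon_def polytope_def)
  have PV: "P = convex hull V" using Krein_Milman_polytope[OF S(1)] S(2) by (simp add: V_def vertices_def)
  have "finite V" using finite_subset[OF extreme_points_of_convex_hull S(1)] S(2) by (simp add: V_def vertices_def)
  have cV: "card V \<le> N" and int: "0 \<in> interior P" using P by (auto simp: admissible_def V_def)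
  have "V \<noteq> {}" using int PV by auto
  have "\<exists>x. x ` {..<N} = V"
  proof -
    obtain h where h: "bij_betw h {..<card V} V" using ex_bij_betw_nat_finite[OF \<open>finite V\<close>] by (auto simp: atLeast0LessThan)
    obtain v where v: "v \<in> V" using \<open>V \<noteq> {}\<close> by blast
    have hV: "h ` {..<card V} = V" using h by (simp add: bij_betw_def)
    \<comment> \<open>Exactly \<open>N\<close> points are required, so missing ones are filled with
      a repeated vertex \<open>v\<close>.\<close>
    define x where "x i = (if i < card V then h i else v)" for i
    have "x ` {..<N} \<subseteq> V" using hV v by (auto simp: x_def)
    moreover have "x ` {..<card V} = V" using hV by (simp add: x_def)
    then have "V \<subseteq> x ` {..<N}" using cV by fastforce
    ultimately have "x ` {..<N} = V" by blast
    then show ?thesis by blast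
  qed
  then obtain y where y: "y ` {..<N} = V" by blast
  define x where "x i = f (y i)" for i
  have xV: "x ` {..<N} = f ` V" by (auto simp: x_def simp flip: y)
  have Q: "convex hull (x ` {..<N}) = f ` P" unfolding xV PV by (rule convex_hull_linear_image[OF lf, symmetric])
  have "complex_of_real (\<rho> / \<gamma>) * cis \<theta> * x i \<in> f ` P" if "i < N" for i
  proof -
    have "y i \<in> P" using that y by (auto simp: PV hull_inc)
    then obtain p where p: "p \<in> P" "T_map \<rho> \<theta> (y i) = \<gamma> *\<^sub>R p" using sub by blast
    have "plane_vec (complex_of_real \<rho> * cis \<theta> * x i) = \<gamma> *\<^sub>R p"
      using p(2) by (simp add: x_def f flip: T_map_plane_vec)
    also have "\<dots> = plane_vec (\<gamma> *\<^sub>R f p)" by (simp add: linear_scale[OF linear_plane_vec] f)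
    finally have "complex_of_real \<rho> * cis \<theta> * x i = \<gamma> *\<^sub>R f p" by (metis f(2))
    then have "complex_of_real (\<rho> / \<gamma>) * cis \<theta> * x i = f p"
      using \<open>0 < \<gamma>\<close> by (simp add: scaleR_conv_of_real field_simps)
    then show ?thesis using p(1) by simp
  qed
  moreover have "\<exists>i<N. x i \<noteq> 0"
  proof (rule ccontr)
    assume "\<not> ?thesis"
    then have "y i = 0" if "i < N" for i using that f(1)[of "y i"] linear_0[OF linear_plane_vec] by (auto simp: x_def)
    then have "V \<subseteq> {0}" using y by auto
    then have "P \<subseteq> {0}" unfolding PV by (intro hull_minimal) auto
    then have "interior P \<subseteq> interior {0}" by (rule interior_mono)
    then show False using int by simp
  qed
  ultimately have "inv_points N (complex_of_real (\<rho> / \<gamma>) * cis \<theta>) x"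
    by (simp add: inv_points_def Q)
  then show ?thesis using mem_Theta_N_iff by blast
qed

lemma admissible_plane_vec_hull:
  assumes "0 \<in> interior (convex hull (x ` {..<N}))"
  shows "admissible N (plane_vec ` (convex hull (x ` {..<N})))" (is "admissible N ?P")
proof -
  have P: "?P = convex hull (plane_vec ` x ` {..<N})"
    by (rule convex_hull_linear_image[OF linear_plane_vec])
  have int: "0 \<in> interior ?P"
    unfolding interior_bijective_linear_image[OF linear_plane_vec bij_plane_vec]
    using assms linear_0[OF linear_plane_vec] by force
  have "vertices ?P \<subseteq> plane_vec ` x ` {..<N}"
    unfolding vertices_def P by (rule extreme_points_of_convex_hull)
  then have "card (vertices ?P) \<le> card (plane_vec ` x ` {..<N})" by (intro card_mono) auto
  also have "\<dots> \<le> N" using card_image_le[of "{..<N}" "\<lambda>i. plane_vec (x i)"] by (simp add: image_image)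
  finally have "card (vertices ?P) \<le> N" .
  moreover have "polytope ?P" unfolding P by (intro polytope_convex_hull) simp
  ultimately show ?thesis using int by (auto simp: admissible_def convex_polygon_def)
qed

lemma T_map_plane_vec_subset:
  assumes Q: "\<And>q. q \<in> Q \<Longrightarrow> complex_of_real K * cis \<theta> * q \<in> Q" and "0 < K"
  shows "T_map \<rho> \<theta> ` plane_vec ` Q \<subseteq> (*\<^sub>R) (\<rho> / K) ` plane_vec ` Q"
proof clarify
  fix q assume "q \<in> Q"
  have "T_map \<rho> \<theta> (plane_vec q) = (\<rho> / K) *\<^sub>R plane_vec (complex_of_real K * cis \<theta> * q)"
  proof -
    have "complex_of_real \<rho> * cis \<theta> * q = (\<rho> / K) *\<^sub>R (complex_of_real K * cis \<theta> * q)"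
      using \<open>0 < K\<close> by (simp add: scaleR_conv_of_real)
    then show ?thesis by (simp only: T_map_plane_vec linear_scale[OF linear_plane_vec])
  qed
  then show "T_map \<rho> \<theta> (plane_vec q) \<in> (*\<^sub>R) (\<rho> / K) ` plane_vec ` Q"
    using Q[OF \<open>q \<in> Q\<close>] by blast
qed

lemma V_gauge_image_le:
  assumes int: "0 \<in> interior P" and "linear f" and "0 < \<gamma>" and sub: "f ` P \<subseteq> (*\<^sub>R) \<gamma> ` P"
  shows "V_gauge P (f x) \<le> \<gamma> * V_gauge P x"
proof -
  define G where "G y = {a. 0 < a \<and> y \<in> (*\<^sub>R) a ` P}" for y
  have bdd: "bdd_below (G y)" for y by (rule bdd_belowI[of _ 0]) (auto simp: G_def)
  obtain e where e: "0 < e" "ball 0 e \<subseteq> P" using int by (auto simp: mem_interior)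
  \<comment> \<open>The infimum over an empty set would carry no information. A ball around 0 inside
    \<open>P\<close> absorbs \<open>x\<close> after division by a large \<open>a\<close>.\<close>
  have "G x \<noteq> {}"
  proof -
    define a where "a = 2 * (norm x + 1) / e"
    have "a > 0" using e by (simp add: a_def add_nonneg_pos)
    have "norm x < 2 * (norm x + 1)" using add_nonneg_pos[of "norm x" 2] by simp
    also have "\<dots> = e * a" using e by (simp add: a_def)
    finally have "norm x < e * a" .
    then have "x /\<^sub>R a \<in> ball 0 e" using \<open>a > 0\<close> by (simp add: field_simps)
    then have "x \<in> (*\<^sub>R) a ` P" using e \<open>a > 0\<close> by (intro image_eqI[of _ _ "x /\<^sub>R a"]) auto
    then show ?thesis using \<open>a > 0\<close> by (auto simp: G_def)
  qed
  have step: "\<gamma> * a \<in> G (f x)" if "a \<in> G x" for a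
  proof -
    obtain p where p: "p \<in> P" "x = a *\<^sub>R p" "a > 0" using \<open>a \<in> G x\<close> by (auto simp: G_def)
    then obtain q where "q \<in> P" "f p = \<gamma> *\<^sub>R q" using sub by blast
    then show ?thesis using p \<open>0 < \<gamma>\<close> by (auto simp: G_def linear_scale[OF \<open>linear f\<close>] mult.commute)
  qed
  have "Inf (G (f x)) / \<gamma> \<le> Inf (G x)"
  proof (rule cInf_greatest[OF \<open>G x \<noteq> {}\<close>])
    fix a assume "a \<in> G x"
    then have "Inf (G (f x)) \<le> \<gamma> * a" using step bdd by (intro cInf_lower)
    then show "Inf (G (f x)) / \<gamma> \<le> a" using \<open>0 < \<gamma>\<close> by (simp add: field_simps)
  qed
  then show ?thesis using \<open>0 < \<gamma>\<close> by (simp add: V_gauge_def G_def field_simps)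
qed

section \<open>Regular polygons\<close>

lemma root_of_unity_power_mem:
  fixes w :: complex
  assumes "w ^ n = 1" "0 < n" "n \<le> N"
  shows "w ^ m \<in> (\<lambda>j. w ^ j) ` {..<N}"
proof -
  have "w ^ m = w ^ (n * (m div n) + m mod n)" by simp
  also have "\<dots> = w ^ (m mod n)" by (simp only: power_add power_mult assms power_one mult_1)
  finally have "w ^ m = w ^ (m mod n)" .
  then show ?thesis using mod_less_divisor[OF \<open>0 < n\<close>, of m] \<open>n \<le> N\<close> by (intro image_eqI[of _ _ "m mod n"]) auto
qed

text \<open>Multiplication by \<open>w\<close> permutes its powers, and the other factor lies on the
  segment from 1 to \<open>w\<close>, so each power is sent between two consecutive powers. Allowing
  \<open>n < N\<close> admits the square for every \<open>N \<ge> 4\<close>.\<close>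

lemma inv_points_roots_of_unity:
  fixes w :: complex
  assumes "w ^ n = 1" "0 < n" "n \<le> N" and t: "0 \<le> t" "t \<le> 1"
  shows "inv_points N (w ^ k * (of_real (1 - t) + of_real t * w)) (\<lambda>j. w ^ j)"
proof -
  have "w ^ k * (of_real (1 - t) + of_real t * w) * w ^ j \<in> convex hull ((\<lambda>j. w ^ j) ` {..<N})" for j
  proof -
    have "(1 - t) *\<^sub>R w ^ (k + j) + t *\<^sub>R w ^ (k + j + 1) \<in> convex hull ((\<lambda>j. w ^ j) ` {..<N})"
      using t assms by (intro convexD convex_convex_hull hull_inc root_of_unity_power_mem) auto
    also have "(1 - t) *\<^sub>R w ^ (k + j) + t *\<^sub>R w ^ (k + j + 1) = w ^ k * (of_real (1 - t) + of_real t * w) * w ^ j"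
      by (simp add: scaleR_conv_of_real power_add algebra_simps)
    finally show ?thesis .
  qed
  moreover have "\<exists>i<N. w ^ i \<noteq> 0" using assms by (intro exI[of _ 0]) auto
  ultimately show ?thesis by (simp add: inv_points_def)
qed

text \<open>Polar form of the boundary of the regular \<open>N\<close>-gon: edge \<open>k\<close>
  has its midpoint at distance \<open>cos (pi / N)\<close> from 0, and \<open>\<delta>\<close> is
  the angle measured from that midpoint.\<close>

lemma Theta_N_regular_polygon:
  assumes "3 \<le> N" and \<delta>: "\<bar>\<delta>\<bar> \<le> pi / N"
  shows "complex_of_real (cos (pi / N) / cos \<delta>) * cis (2 * (pi / N) * real k + pi / N + \<delta>) \<in> Theta_N N"
proof -
  define a where "a = pi / N"
  have "a \<le> pi / 3" unfolding a_def using assms by (intro divide_left_mono) auto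
  then have a: "0 < a" "a < pi / 2" using assms pi_gt_zero by (simp add: a_def, linarith)
  have sa: "sin a > 0" using a by (intro sin_gt_zero) auto
  have \<delta>a: "\<bar>\<delta>\<bar> \<le> a" using \<delta> by (simp add: a_def)
  have cd: "cos \<delta> > 0" using \<delta>a a by (intro cos_gt_zero_pi) linarith+
  have sp: "sin (a + \<delta>) \<ge> 0" "sin (a - \<delta>) \<ge> 0"
    using \<delta>a a by (intro sin_ge_zero; linarith)+
  \<comment> \<open>By the sine rule, the ray at angle \<open>a + \<delta>\<close> divides the edge
    from 1 to \<open>cis (2 * a)\<close> in the ratio \<open>sin (a + \<delta>)\<close> to
    \<open>sin (a - \<delta>)\<close>.\<close>
  define t where "t = sin (a + \<delta>) / (2 * sin a * cos \<delta>)"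
  have sum: "sin (a + \<delta>) + sin (a - \<delta>) = 2 * sin a * cos \<delta>" by (simp add: sin_add sin_diff)
  have t1: "1 - t = sin (a - \<delta>) / (2 * sin a * cos \<delta>)"
    using sa cd sum by (simp add: t_def diff_divide_eq_iff)
  have t: "0 \<le> t" "t \<le> 1"
  proof -
    show "0 \<le> t" using sp sa cd by (simp add: t_def)
    have "0 \<le> 1 - t" using sp sa cd by (simp add: t1)
    then show "t \<le> 1" by simp
  qed
  have "real N * (2 * a) = 2 * pi" using assms by (simp add: a_def)
  then have root: "cis (2 * a) ^ N = 1" by (simp only: Complex.DeMoivre cis_2pi)
  have diff: "sin (a - \<delta>) = sin (2 * a) * cos (a + \<delta>) - cos (2 * a) * sin (a + \<delta>)"
    using sin_diff[of "2 * a" "a + \<delta>"] by simp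
  have "complex_of_real (2 * sin a * cos \<delta>) * (complex_of_real (cos a / cos \<delta>) * cis (a + \<delta>))
      = of_real (sin (2 * a)) * cis (a + \<delta>)"
    using cd by (simp add: sin_double)
  also have "\<dots> = of_real (sin (a - \<delta>)) + of_real (sin (a + \<delta>)) * cis (2 * a)"
    by (simp add: complex_eq_iff diff)
  also have "\<dots> = complex_of_real (2 * sin a * cos \<delta>) * (of_real (1 - t) + of_real t * cis (2 * a))"
    unfolding t1 using sa cd by (simp add: t_def distrib_left)
  finally have "complex_of_real (cos a / cos \<delta>) * cis (a + \<delta>) = of_real (1 - t) + of_real t * cis (2 * a)"
    using sa cd by (metis mult_cancel_left mult_pos_pos of_real_eq_0_iff order_less_irrefl zero_less_numeral)
  moreover have "cis (2 * a * real k + a + \<delta>) = cis (2 * a) ^ k * cis (a + \<delta>)"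
    by (simp add: Complex.DeMoivre cis_mult algebra_simps)
  ultimately have "complex_of_real (cos a / cos \<delta>) * cis (2 * a * real k + a + \<delta>) =
      cis (2 * a) ^ k * (of_real (1 - t) + of_real t * cis (2 * a))"
    by (metis mult.left_commute)
  then show ?thesis using inv_points_roots_of_unity[OF root _ order_refl t, of k] assms
    by (auto simp: mem_Theta_N_iff simp flip: a_def)
qed

section \<open>Lower bound and first sector for \<open>K_N\<close>\<close>

lemma pi_div_nat_bounds:
  assumes "4 \<le> N"
  shows "0 < pi / real N" "pi / real N \<le> pi / 4" "0 < cos (pi / real N)"
proof -
  show 0: "0 < pi / real N" using assms by simp
  show "pi / real N \<le> pi / 4" using assms by (intro divide_left_mono) auto
  then show "0 < cos (pi / real N)" using 0 pi_gt_zero by (intro cos_gt_zero) linarith+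
qed

lemma K_N_ge_cos:
  assumes N: "4 \<le> N" and "0 \<le> \<theta>"
  shows "cos (pi / N) \<le> K_N N \<theta>"
proof -
  define a where "a = pi / N"
  have a: "0 < a" "a \<le> pi / 4" "0 < cos a" using pi_div_nat_bounds[OF N] by (auto simp: a_def)
  \<comment> \<open>The edge of the regular polygon that the ray at angle \<open>\<theta>\<close>
    meets.\<close>
  define k where "k = nat \<lfloor>\<theta> / (2 * a)\<rfloor>"
  have k: "real k \<le> \<theta> / (2 * a)" "\<theta> / (2 * a) < real k + 1"
    using \<open>0 \<le> \<theta>\<close> a by (auto simp: k_def)
  define \<delta> where "\<delta> = \<theta> - 2 * a * real k - a"
  have "\<bar>\<delta>\<bar> \<le> a" using k a by (simp add: \<delta>_def field_simps abs_le_iff)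
  then have cd: "0 < cos \<delta>" using a pi_gt_zero by (intro cos_gt_zero_pi) linarith+
  have "complex_of_real (cos a / cos \<delta>) * cis (2 * a * real k + a + \<delta>) \<in> Theta_N N"
    unfolding a_def using N \<open>\<bar>\<delta>\<bar> \<le> a\<close> by (intro Theta_N_regular_polygon) (auto simp: a_def)
  then have "complex_of_real (cos a / cos \<delta>) * cis \<theta> \<in> Theta_N N" by (simp add: \<delta>_def)
  then have "cos a / cos \<delta> \<le> K_N N \<theta>" using N a cd by (intro K_N_greatest) auto
  moreover have "cos a * cos \<delta> \<le> cos a" using a by (simp add: mult_left_le)
  then have "cos a \<le> cos a / cos \<delta>" using cd by (simp add: le_divide_eq)
  ultimately show ?thesis by (simp add: a_def)
qed

lemma K_N_sector:
  assumes N: "4 \<le> N" and \<theta>: "0 \<le> \<theta>" "\<theta> \<le> 2 * pi / N"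
  shows "K_N N \<theta> = cos (pi / N) / cos (\<theta> - pi / N)"
proof (rule antisym)
  define a where "a = pi / N"
  have a: "0 < a" "a \<le> pi / 4" "0 < cos a" using pi_div_nat_bounds[OF N] by (auto simp: a_def)
  have \<theta>a: "\<bar>\<theta> - a\<bar> \<le> a" using \<theta> by (simp add: a_def abs_le_iff)
  have cd: "0 < cos (\<theta> - a)" using a \<theta>a pi_gt_zero by (intro cos_gt_zero_pi) linarith+
  have "complex_of_real (cos a / cos (\<theta> - a)) * cis (2 * a * real 0 + a + (\<theta> - a)) \<in> Theta_N N"
    unfolding a_def using N \<theta>a by (intro Theta_N_regular_polygon) (auto simp: a_def)
  then show "cos (pi / N) / cos (\<theta> - pi / N) \<le> K_N N \<theta>"
    using N a cd by (intro K_N_greatest) (auto simp: a_def)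
  define r where "r = K_N N \<theta>"
  have r: "0 \<le> r" "complex_of_real r * cis \<theta> \<in> Theta_N N"
    using K_N_greatest(1,2)[of N \<theta>] N by (auto simp: r_def)
  have "r * cos (\<theta> - a) \<le> cos a"
  \<comment> \<open>The half-plane bound needs a point above the real axis. What remains is
    \<open>r = 0\<close> or \<open>\<theta> = 0\<close>, where \<open>r \<le> 1\<close>
    suffices.\<close>
  proof (cases "0 < r * sin \<theta>")
    case True
    obtain x where "inv_points N (complex_of_real r * cis \<theta>) x" using r mem_Theta_N_iff by blast
    from inv_points_upper_bound[OF this] True show ?thesis
      by (simp add: a_def cos_diff algebra_simps)
  next
    case False
    have "\<theta> < pi" using \<theta>a a pi_gt_zero by linarith
    then have "r = 0 \<or> \<theta> = 0" using False \<theta> r sin_gt_zero[of \<theta>] by (force simp: zero_less_mult_iff)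
    moreover have "r \<le> 1" using norm_Theta_N_le[OF r(2)] r(1) by (simp add: norm_mult)
    ultimately show ?thesis using a by (auto simp: mult_left_le_one_le)
  qed
  then show "K_N N \<theta> \<le> cos (pi / N) / cos (\<theta> - pi / N)"
    using cd by (simp add: le_divide_eq r_def a_def)
qed

section \<open>Optimal polygons\<close>

text \<open>Steps shorter than \<open>pi\<close> cannot jump over the open half-turn on which the
  cosine is negative.\<close>

lemma cos_progression_negative:
  assumes "0 < \<theta>" "\<theta> < pi" "- pi < \<phi>" "\<phi> \<le> pi"
  shows "\<exists>k::nat. cos (\<phi> + real k * \<theta>) < 0"
proof (cases "\<phi> \<le> pi / 2")
  case True
  \<comment> \<open>The first index past \<open>pi / 2\<close>; its predecessor is at most
    \<open>pi / 2\<close>, so this term stays below \<open>3 * pi / 2\<close>.\<close>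
  define k where "k = nat \<lfloor>(pi / 2 - \<phi>) / \<theta>\<rfloor> + 1"
  have "0 \<le> (pi / 2 - \<phi>) / \<theta>" using True assms by simp
  then have "real k = real_of_int \<lfloor>(pi / 2 - \<phi>) / \<theta>\<rfloor> + 1" by (simp add: k_def)
  then have "real k - 1 \<le> (pi / 2 - \<phi>) / \<theta>" "(pi / 2 - \<phi>) / \<theta> < real k" by linarith+
  then have k: "(real k - 1) * \<theta> \<le> pi / 2 - \<phi>" "pi / 2 - \<phi> < real k * \<theta>"
    using assms by (simp_all only: le_divide_eq divide_less_eq if_True)
  have "0 < cos (\<phi> + real k * \<theta> - pi)"
    using k assms by (intro cos_gt_zero_pi) (simp_all add: algebra_simps)
  then have "cos (\<phi> + real k * \<theta>) < 0" by (simp add: cos_diff)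
  then show ?thesis ..
next
  case False
  then have "0 < cos (\<phi> - pi)" using assms by (intro cos_gt_zero_pi) auto
  then show ?thesis by (intro exI[of _ 0]) (simp add: cos_diff)
qed

text \<open>A set with empty interior lies in a hyperplane, which passes through 0. Otherwise 0 is
  separated from the interior, and the inequality extends to the closure.\<close>

lemma convex_supporting_halfspace:
  fixes S :: "'a::euclidean_space set"
  assumes S: "convex S" "0 \<in> S" "0 \<notin> interior S"
  obtains a where "a \<noteq> 0" "\<And>y. y \<in> S \<Longrightarrow> 0 \<le> a \<bullet> y"
proof (cases "interior S = {}")
  case True
  then obtain a b where "a \<noteq> 0" "S \<subseteq> {x. a \<bullet> x = b}"
    using empty_interior_subset_hyperplane[OF \<open>convex S\<close>] by blast
  moreover from this have "b = 0" using \<open>0 \<in> S\<close> by auto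
  ultimately show thesis by (intro that[of a]) auto
next
  case False
  obtain a b where a: "a \<noteq> 0" "\<forall>x\<in>{0}. a \<bullet> x \<le> b" "\<forall>x\<in>interior S. b \<le> a \<bullet> x"
    using separating_hyperplane_sets[of "{0}" "interior S"] S False by (auto simp: convex_interior)
  then have "interior S \<subseteq> {x. 0 \<le> a \<bullet> x}" by force
  then have "closure (interior S) \<subseteq> {x. 0 \<le> a \<bullet> x}"
    using closed_halfspace_ge[of 0 a] by (intro closure_minimal) (auto simp: inner_commute)
  then have "S \<subseteq> {x. 0 \<le> a \<bullet> x}"
    using convex_closure_interior[OF \<open>convex S\<close> False] closure_subset[of S] by blast
  then show thesis using a by (intro that[of a]) auto
qed

text \<open>Otherwise a half-plane bounded by a line through 0 contains the hull, but the points
  \<open>z ^ k * x i\<close> turn by \<open>Arg z\<close> between 0 and \<open>pi\<close> at each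
  step and eventually leave it.\<close>

lemma inv_points_zero_mem_interior:
  assumes x: "inv_points N z x" and z: "Im z > 0"
  shows "0 \<in> interior (convex hull (x ` {..<N}))"
proof (rule ccontr)
  let ?Q = "convex hull (x ` {..<N})"
  assume "0 \<notin> interior ?Q"
  moreover have "z \<noteq> 1" using z by auto
  then have "0 \<in> ?Q" by (rule inv_points_zero_mem_hull[OF x])
  ultimately obtain a where a: "a \<noteq> 0" "\<And>y. y \<in> ?Q \<Longrightarrow> 0 \<le> a \<bullet> y"
    using convex_supporting_halfspace[OF convex_convex_hull] by blast
  obtain i where i: "i < N" "x i \<noteq> 0" using x by (auto simp: inv_points_def)
  have inv: "\<forall>i<N. z * x i \<in> ?Q" using x by (simp add: inv_points_def)
  have mem: "z ^ k * x i \<in> ?Q" for k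
  proof (induction k)
    case (Suc k)
    have "z * (z ^ k * x i) \<in> ?Q" by (rule inv_points_mult_hull[OF inv Suc])
    then show ?case by (simp add: mult.assoc)
  qed (use i in \<open>simp add: hull_inc\<close>)
  \<comment> \<open>The real part of \<open>c * z ^ k\<close> is the inner product of
    \<open>a\<close> with \<open>z ^ k * x i\<close>, and its sign is that of a cosine along an
    arithmetic progression.\<close>
  define c where "c = cnj a * x i"
  have "c \<noteq> 0" "z \<noteq> 0" using a i z by (auto simp: c_def)
  obtain k where k: "cos (Arg c + real k * Arg z) < 0"
    using cos_progression_negative[of "Arg z" "Arg c"] Arg_lt_pi[of z] z Arg_bounded[of c] by auto
  have "c * z ^ k = rcis (norm c) (Arg c) * rcis (norm z) (Arg z) ^ k" by (simp add: rcis_cmod_Arg)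
  also have "\<dots> = rcis (norm c * norm z ^ k) (Arg c + real k * Arg z)"
    by (simp add: DeMoivre2 rcis_mult)
  finally have "Re (c * z ^ k) = norm c * norm z ^ k * cos (Arg c + real k * Arg z)" by simp
  also have "\<dots> < 0" using k \<open>c \<noteq> 0\<close> \<open>z \<noteq> 0\<close> by (intro mult_pos_neg) auto
  also have "Re (c * z ^ k) = a \<bullet> (z ^ k * x i)"
    by (simp add: c_def inner_complex_def algebra_simps)
  finally show False using a(2)[OF mem[of k]] by simp
qed

lemma K_N_optimal_polygon:
  assumes N: "4 \<le> N" and \<theta>: "0 \<le> \<theta>" "\<theta> \<le> pi"
  obtains x where "0 \<in> interior (convex hull (x ` {..<N}))"
    "\<And>q. q \<in> convex hull (x ` {..<N}) \<Longrightarrow> complex_of_real (K_N N \<theta>) * cis \<theta> * q \<in> convex hull (x ` {..<N})"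
proof (cases "0 < \<theta> \<and> \<theta> < pi")
  case True
  define z where "z = complex_of_real (K_N N \<theta>) * cis \<theta>"
  have "0 < K_N N \<theta>" using K_N_ge_cos[OF N \<theta>(1)] pi_div_nat_bounds(3)[OF N] by linarith
  then have Im: "Im z > 0" using True by (simp add: z_def sin_gt_zero)
  have "z \<in> Theta_N N" unfolding z_def using N by (intro K_N_greatest) auto
  then obtain x where x: "inv_points N z x" using mem_Theta_N_iff by blast
  have "z * q \<in> convex hull (x ` {..<N})" if "q \<in> convex hull (x ` {..<N})" for q
    using x that by (intro inv_points_mult_hull) (auto simp: inv_points_def)
  then show thesis using inv_points_zero_mem_interior[OF x Im] unfolding z_def by (intro that)
next
  case False
  \<comment> \<open>For \<open>\<theta> = 0\<close> or \<open>\<theta> = pi\<close> a square is optimal; this is where \<open>4 \<le> N\<close> matters.\<close>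
  define x where "x j = \<i> ^ j" for j :: nat
  have i4: "\<i> ^ 4 = 1" by (simp add: numeral_eq_Suc)
  have x: "inv_points N (\<i> ^ k) x" for k
    using inv_points_roots_of_unity[OF i4 _ N, of 0 k] by (simp add: x_def[abs_def])
  have "cis \<theta> = 1 \<or> cis \<theta> = -1" using False \<theta> by (auto simp: complex_eq_iff)
  then obtain k where k: "cis \<theta> = \<i> ^ k" by (metis power_0 i_squared power2_eq_square)
  have "cis \<theta> \<in> Theta_N N" using x[of k] k mem_Theta_N_iff by auto
  then have "1 \<le> K_N N \<theta>" using N by (intro K_N_greatest) auto
  moreover have "K_N N \<theta> \<le> 1"
    using norm_Theta_N_le[OF K_N_greatest(2)[of N \<theta>]] K_N_greatest(1)[of N \<theta>] N by (simp add: norm_mult)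
  ultimately have "complex_of_real (K_N N \<theta>) * cis \<theta> = \<i> ^ k" by (simp add: k)
  moreover have "\<i> ^ k * q \<in> convex hull (x ` {..<N})" if "q \<in> convex hull (x ` {..<N})" for q
    using x that by (intro inv_points_mult_hull) (auto simp: inv_points_def)
  \<comment> \<open>A real multiplier gives no interior point, but the same square is also invariant
    under multiplication by the imaginary unit.\<close>
  moreover have "0 \<in> interior (convex hull (x ` {..<N}))"
    using inv_points_zero_mem_interior[OF x[of 1]] by simp
  ultimately show thesis by (intro that) auto
qed

section \<open>Attainment of the infimum and the extrema\<close>

lemma Gamma_N_attained:
  assumes N: "4 \<le> N" and "0 < \<rho>" and \<theta>: "0 \<le> \<theta>" "\<theta> \<le> pi"
  shows "Gamma_N N (T_map \<rho> \<theta>) = \<rho> / K_N N \<theta>" "0 < \<rho> / K_N N \<theta>"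
    "\<exists>P. admissible N P \<and> T_map \<rho> \<theta> ` P \<subseteq> (*\<^sub>R) (\<rho> / K_N N \<theta>) ` P"
proof -
  have K: "0 < K_N N \<theta>" using K_N_ge_cos[OF N \<theta>(1)] pi_div_nat_bounds(3)[OF N] by linarith
  then show pos: "0 < \<rho> / K_N N \<theta>" using \<open>0 < \<rho>\<close> by simp
  obtain x where x: "0 \<in> interior (convex hull (x ` {..<N}))"
    "\<And>q. q \<in> convex hull (x ` {..<N}) \<Longrightarrow> complex_of_real (K_N N \<theta>) * cis \<theta> * q \<in> convex hull (x ` {..<N})"
    using K_N_optimal_polygon[OF N \<theta>] by blast
  then show ex: "\<exists>P. admissible N P \<and> T_map \<rho> \<theta> ` P \<subseteq> (*\<^sub>R) (\<rho> / K_N N \<theta>) ` P"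
    using admissible_plane_vec_hull[OF x(1)] T_map_plane_vec_subset[OF x(2) K] by blast
  show "Gamma_N N (T_map \<rho> \<theta>) = \<rho> / K_N N \<theta>" unfolding Gamma_N_def
  proof (rule cInf_eq_minimum)
    show "\<rho> / K_N N \<theta> \<in> {\<gamma>. 0 < \<gamma> \<and> (\<exists>P. admissible N P \<and> T_map \<rho> \<theta> ` P \<subseteq> (*\<^sub>R) \<gamma> ` P)}"
      using pos ex by blast
    fix \<gamma> assume "\<gamma> \<in> {\<gamma>. 0 < \<gamma> \<and> (\<exists>P. admissible N P \<and> T_map \<rho> \<theta> ` P \<subseteq> (*\<^sub>R) \<gamma> ` P)}"
    then obtain P where \<gamma>: "0 < \<gamma>" and "complex_of_real (\<rho> / \<gamma>) * cis \<theta> \<in> Theta_N N"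
      using T_map_subset_imp_Theta_N by blast
    \<comment> \<open>Every competing polygon gives an eigenvalue of modulus
      \<open>\<rho> / \<gamma>\<close> in direction \<open>\<theta>\<close>, so the maximality of
      \<open>K_N\<close> bounds \<open>\<gamma>\<close> from below.\<close>
    then have "\<rho> / \<gamma> \<le> K_N N \<theta>" using N \<open>0 < \<rho>\<close> by (intro K_N_greatest) auto
    then show "\<rho> / K_N N \<theta> \<le> \<gamma>" using K \<gamma> by (simp add: field_simps)
  qed
qed

theorem theorem7p1:
  fixes N :: nat and \<rho> :: real
  assumes "4 \<le> N" and "0 < \<rho>"
  shows
    "(\<forall>\<theta>. 0 \<le> \<theta> \<and> \<theta> \<le> pi \<longrightarrow>
        Gamma_N N (T_map \<rho> \<theta>) = \<rho> / K_N N \<theta> \<and>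
        (\<exists>P. admissible N P \<and>
             0 < Gamma_N N (T_map \<rho> \<theta>) \<and>
             T_map \<rho> \<theta> ` P \<subseteq> (*\<^sub>R) (Gamma_N N (T_map \<rho> \<theta>)) ` P \<and>
             (\<forall>x. V_gauge P (T_map \<rho> \<theta> x) \<le> Gamma_N N (T_map \<rho> \<theta>) * V_gauge P x))) \<and>
     is_arg_min (K_N N) (\<lambda>\<theta>. 0 \<le> \<theta> \<and> \<theta> \<le> pi) (pi / real N) \<and>
     K_N N (pi / real N) = cos (pi / real N) \<and>
     is_arg_max (\<lambda>\<theta>. Gamma_N N (T_map \<rho> \<theta>) / \<rho>) (\<lambda>\<theta>. 0 \<le> \<theta> \<and> \<theta> \<le> pi) (pi / real N) \<and>
     Gamma_N N (T_map \<rho> (pi / real N)) / \<rho> = 1 / cos (pi / real N) \<and>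
     (\<forall>\<theta>. 0 \<le> \<theta> \<and> \<theta> \<le> 2 * pi / real N \<longrightarrow>
        K_N N \<theta> = cos (pi / real N) / cos (\<theta> - pi / real N))"
proof -
  note N = assms(1)
  have a: "0 \<le> pi / real N" "pi / real N \<le> pi" "pi / real N \<le> 2 * pi / real N"
    using pi_div_nat_bounds[OF N] pi_gt_zero by (linarith | simp)+
  have Kmin: "K_N N (pi / real N) = cos (pi / real N)" using K_N_sector[OF N a(1,3)] by simp
  have Kge: "cos (pi / real N) \<le> K_N N \<theta>" if "0 \<le> \<theta>" for \<theta> by (rule K_N_ge_cos[OF N that])
  have G: "Gamma_N N (T_map \<rho> \<theta>) / \<rho> = 1 / K_N N \<theta>" if "0 \<le> \<theta>" "\<theta> \<le> pi" for \<theta>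
    using Gamma_N_attained(1)[OF assms that] \<open>0 < \<rho>\<close> by simp
  have Gle: "1 / K_N N \<theta> \<le> 1 / cos (pi / real N)" if "0 \<le> \<theta>" for \<theta>
    using Kge[OF that] pi_div_nat_bounds(3)[OF N] by (intro divide_left_mono) auto
  have main: "\<exists>P. admissible N P \<and>
             0 < Gamma_N N (T_map \<rho> \<theta>) \<and>
             T_map \<rho> \<theta> ` P \<subseteq> (*\<^sub>R) (Gamma_N N (T_map \<rho> \<theta>)) ` P \<and>
             (\<forall>x. V_gauge P (T_map \<rho> \<theta> x) \<le> Gamma_N N (T_map \<rho> \<theta>) * V_gauge P x)"
    if \<theta>: "0 \<le> \<theta>" "\<theta> \<le> pi" for \<theta>
  proof -
    obtain P where P: "admissible N P" "T_map \<rho> \<theta> ` P \<subseteq> (*\<^sub>R) (\<rho> / K_N N \<theta>) ` P"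
      using Gamma_N_attained(3)[OF assms \<theta>] by blast
    have "V_gauge P (T_map \<rho> \<theta> x) \<le> \<rho> / K_N N \<theta> * V_gauge P x" for x
      using P Gamma_N_attained(2)[OF assms \<theta>]
      by (intro V_gauge_image_le linear_T_map) (auto simp: admissible_def)
    then show ?thesis using P Gamma_N_attained(1,2)[OF assms \<theta>] by auto
  qed
  show ?thesis
  proof (intro conjI allI impI)
    show "is_arg_min (K_N N) (\<lambda>\<theta>. 0 \<le> \<theta> \<and> \<theta> \<le> pi) (pi / real N)"
      using a Kge by (auto simp: is_arg_min_def Kmin not_less)
    show "is_arg_max (\<lambda>\<theta>. Gamma_N N (T_map \<rho> \<theta>) / \<rho>) (\<lambda>\<theta>. 0 \<le> \<theta> \<and> \<theta> \<le> pi) (pi / real N)"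
      using a Gle by (auto simp: is_arg_max_def G Kmin not_less)
    show "Gamma_N N (T_map \<rho> (pi / real N)) / \<rho> = 1 / cos (pi / real N)" using G a Kmin by simp
  qed (use main Kmin Gamma_N_attained(1)[OF assms] K_N_sector[OF N] in auto)
qed

end
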